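(* Let $\{x_k\}_{k\ge1}$ be the infinite sequence of iterates of the SZO-QQ algorithm with its termination conditions removed. Suppose $x_c$ is an accumulation point of $\{x_k\}_{k\ge1}$ at which the Linear Independence Constraint Qualification (LICQ) holds, i.e. the gradients $\nabla f_i(x_c)$, $i\in\mathcal{A}(x_c)=\{i\in\{1,\dots,m\}: f_i(x_c)=0\}$, are linearly independent. Then there exists a unique $\lambda_c\in\mathbb{R}^m_{\ge0}$ such that $(x_c,\lambda_c)$ is a KKT pair of the problem $\min_{x\in\Omega}f_0(x)$.
   Context: Problem. Let $d,m\ge1$, let $f_0,\dots,f_m:\mathbb{R}^d\to\mathbb{R}$ be continuously differentiable with $f_0$ linear, and $\Omega=\{x\in\mathbb{R}^d: f_i(x)\le0,\ i=1,\dots,m\}$. The problem is $\min_{x\in\Omega}f_0(x)$. $\|\cdot\|$ is the Euclidean norm, $e_j$ the standard basis vectors. Standing assumptions. (1) There are constants $L_i,M_i>0$ ($i=0,\dots,m$) and a set $\overline\Omega\supset\Omega$ such that for all $x_1,x_2\in\overline\Omega$: $|f_i(x_1)-f_i(x_2)|\le L_i\|x_1-x_2\|$ and $\|\nabla f_i(x_1)-\nabla f_i(x_2)\|\le M_i\|x_1-x_2\|$; moreover $L_i>L_{i,\inf}$ and $M_i>M_{i,\inf}$, the infima of the constants for which these inequalities hold for all $x_1,x_2\in\Omega$. (2) $x_0$ is a given strictly feasible point: $f_i(x_0)<0$ for $i=1,\dots,m$. (3) There is $\beta\in\mathbb{R}$ such that $\{x\in\Omega: f_0(x)\le\beta\}$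 is bounded and contains $x_0$. SZO-QQ iterates. Fix parameters $\mu,\Lambda,\eta>0$. Let $L_{\max}=\max_{1\le i\le m}L_i$, $\alpha_i=\sqrt d\,M_i/2$, $\alpha_{\max}=\max_{1\le i\le m}\alpha_i$, and $\nabla^{\nu}f_i(x)=\sum_{j=1}^d\frac{f_i(x+\nu e_j)-f_i(x)}{\nu}e_j$. For $k\ge0$, given $x_k$, put $l_k^*=\min_{1\le i\le m}(-f_i(x_k))/L_{\max}$, $\nu_k^*=\min\{l_k^*/\sqrt d,\ 1/\max\{k,1\},\ \eta/(12\alpha_{\max}m\Lambda)\}$, $$\mathcal{S}^{(k)}(x_k)=\bigcap_{i=1}^m\{x: f_i(x_k)+\nabla^{\nu_k^*}f_i(x_k)^\top(x-x_k)+2M_i\|x-x_k\|^2\le0\},$$ and let $x_{k+1}$ be the minimizer of $f_0(x)+\mu\|x-x_k\|^2$ over $x\in\mathcal{S}^{(k)}(x_k)$. KKT pair. $(x,\lambda)\in\Omega\times\mathbb{R}^m_{\ge0}$ is a KKT pair of $\min_{x\in\Omega}f_0(x)$ if $\nabla f_0(x)+\sum_{i=1}^m\lambda^{(i)}\nabla f_i(x)=0$ and $\lambda^{(i)}f_i(x)=0$ for $i=1,\dots,m$. *)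

theory Defs
  imports "HOL-Analysis.Analysis"
begin

text \<open>
  The space is \<open>real ^ 'd\<close>, and the constraints \<open>f i\<close> are indexed by a finite type \<open>'m\<close>, so that
  \<open>d = CARD('d)\<close>, \<open>m = CARD('m)\<close>, and multipliers are vectors in \<open>real ^ 'm\<close>.
  The objective \<open>f0\<close> and its constants \<open>L0\<close>, \<open>M0\<close> are kept separate from the constraint families.
\<close>

definition grad :: "('a::real_inner \<Rightarrow> real) \<Rightarrow> 'a \<Rightarrow> 'a" where
  "grad h x = (THE D. GDERIV h x :> D)"

lemma grad_eqI:
  assumes "GDERIV h x :> D"
  shows "grad h x = D"
  unfolding grad_def
proof (rule the_equality[where P = "\<lambda>D. GDERIV h x :> D", OF assms])
  fix D' assume "GDERIV h x :> D'"
  then have "(\<lambda>v. v \<bullet> D') = (\<lambda>v. v \<bullet> D)"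
    using assms unfolding gderiv_def by (rule has_derivative_unique)
  then have "(D' - D) \<bullet> (D' - D) = 0"
    by (metis inner_diff_right right_minus_eq)
  then show "D' = D"
    by simp
qed

definition continuously_differentiable :: "(real ^ 'd \<Rightarrow> real) \<Rightarrow> bool" where
  "continuously_differentiable h \<longleftrightarrow>
     (\<forall>x. h differentiable (at x)) \<and> continuous_on UNIV (grad h)"

lemma continuously_differentiable_GDERIV:
  fixes h :: "real ^ 'd \<Rightarrow> real"
  assumes "continuously_differentiable h"
  shows "GDERIV h x :> grad h x"
proof -
  obtain h' where h': "(h has_derivative h') (at x)"
    using assms unfolding continuously_differentiable_def differentiable_def by blast
  interpret linear h'
    using h' by (rule has_derivative_linear)
  have "h' v = v \<bullet> adjoint h' 1" for v
    using adjoint_works[OF linear_axioms, of v 1] by simp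
  then have "h' = (\<lambda>v. v \<bullet> adjoint h' 1)"
    by blast
  then have "GDERIV h x :> adjoint h' 1"
    using h' unfolding gderiv_def by simp
  then show ?thesis
    using grad_eqI by metis
qed

definition feasible_set :: "('m::finite \<Rightarrow> real ^ 'd \<Rightarrow> real) \<Rightarrow> (real ^ 'd) set" where
  "feasible_set f = {x. \<forall>i. f i x \<le> 0}"

text \<open>
  \<open>Ls\<close> and \<open>Ms\<close> are Lipschitz constants of \<open>h\<close> and of its gradient on the larger set \<open>W'\<close>, and they
  strictly exceed the best such constants on \<open>W\<close>.
\<close>

definition smoothness_constants ::
  "(real ^ 'd \<Rightarrow> real) \<Rightarrow> real \<Rightarrow> real \<Rightarrow> (real ^ 'd) set \<Rightarrow> (real ^ 'd) set \<Rightarrow> bool" where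
  "smoothness_constants h Ls Ms W W' \<longleftrightarrow>
     0 < Ls \<and> 0 < Ms \<and>
     Ls-lipschitz_on W' h \<and> Ms-lipschitz_on W' (grad h) \<and>
     Inf {c. c-lipschitz_on W h} < Ls \<and> Inf {c. c-lipschitz_on W (grad h)} < Ms"

definition fd_grad :: "real \<Rightarrow> (real ^ 'd \<Rightarrow> real) \<Rightarrow> real ^ 'd \<Rightarrow> real ^ 'd" where
  "fd_grad \<nu> h x = (\<Sum>j\<in>UNIV. ((h (x + \<nu> *\<^sub>R axis j 1) - h x) / \<nu>) *\<^sub>R axis j 1)"

definition l_star :: "('m::finite \<Rightarrow> real) \<Rightarrow> ('m \<Rightarrow> real ^ 'd \<Rightarrow> real) \<Rightarrow> real ^ 'd \<Rightarrow> real" where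
  "l_star L f x = (MIN i. - f i x) / (MAX i. L i)"

text \<open>In \<open>\<alpha>\<^sub>i = \<surd>d M\<^sub>i / 2\<close>, the maximum over \<open>i\<close> ranges over the constraints only.\<close>

definition alpha_max :: "'d itself \<Rightarrow> ('m::finite \<Rightarrow> real) \<Rightarrow> real" where
  "alpha_max _ M = (MAX i. sqrt (real CARD('d)) * M i / 2)"

definition nu_star ::
  "real \<Rightarrow> real \<Rightarrow> ('m::finite \<Rightarrow> real) \<Rightarrow> ('m \<Rightarrow> real) \<Rightarrow> ('m \<Rightarrow> real ^ 'd \<Rightarrow> real) \<Rightarrow>
   nat \<Rightarrow> real ^ 'd \<Rightarrow> real" where
  "nu_star \<Lambda> \<eta> L M f k x =
     Min {l_star L f x / sqrt (real CARD('d)),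
          1 / real (max k 1),
          \<eta> / (12 * alpha_max TYPE('d) M * real CARD('m) * \<Lambda>)}"

definition local_feasible_set ::
  "real \<Rightarrow> ('m::finite \<Rightarrow> real) \<Rightarrow> ('m \<Rightarrow> real ^ 'd \<Rightarrow> real) \<Rightarrow> real ^ 'd \<Rightarrow> (real ^ 'd) set" where
  "local_feasible_set \<nu> M f y =
     (\<Inter>i. {x. f i y + fd_grad \<nu> (f i) y \<bullet> (x - y) + 2 * M i * (norm (x - y))\<^sup>2 \<le> 0})"

text \<open>
  The subproblem objective is strongly convex when \<open>f0\<close> is linear and \<open>\<mu> > 0\<close>, and its feasible set is
  convex when all \<open>M i > 0\<close>, so the minimizer selected by \<open>is_arg_min\<close> is unique.
\<close>

definition szo_qq_iterates ::
  "real \<Rightarrow> real \<Rightarrow> real \<Rightarrow> ('m::finite \<Rightarrow> real) \<Rightarrow> ('m \<Rightarrow> real) \<Rightarrow> (real ^ 'd \<Rightarrow> real) \<Rightarrow>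
   ('m \<Rightarrow> real ^ 'd \<Rightarrow> real) \<Rightarrow> real ^ 'd \<Rightarrow> (nat \<Rightarrow> real ^ 'd) \<Rightarrow> bool" where
  "szo_qq_iterates \<mu> \<Lambda> \<eta> L M f0 f x0 x \<longleftrightarrow>
     x 0 = x0 \<and>
     (\<forall>k. is_arg_min (\<lambda>y. f0 y + \<mu> * (norm (y - x k))\<^sup>2)
            (\<lambda>y. y \<in> local_feasible_set (nu_star \<Lambda> \<eta> L M f k (x k)) M f (x k))
            (x (Suc k)))"

text \<open>
  Accumulation points are those of the sequence, not of its range: a value attained infinitely often
  counts.
\<close>

definition accumulation_point :: "(nat \<Rightarrow> 'a::topological_space) \<Rightarrow> 'a \<Rightarrow> bool" where
  "accumulation_point X c \<longleftrightarrow> (\<exists>r. strict_mono r \<and> (X \<circ> r) \<longlonglongrightarrow> c)"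

definition active_set :: "('m::finite \<Rightarrow> real ^ 'd \<Rightarrow> real) \<Rightarrow> real ^ 'd \<Rightarrow> 'm set" where
  "active_set f x = {i. f i x = 0}"

text \<open>
  Linear independence of the family of active gradients: \<open>independent\<close> speaks about a set, so
  injectivity is needed to exclude two active constraints with the same gradient.
\<close>

definition LICQ :: "('m::finite \<Rightarrow> real ^ 'd \<Rightarrow> real) \<Rightarrow> real ^ 'd \<Rightarrow> bool" where
  "LICQ f x \<longleftrightarrow>
     inj_on (\<lambda>i. grad (f i) x) (active_set f x) \<and>
     independent ((\<lambda>i. grad (f i) x) ` active_set f x)"

definition KKT_pair ::
  "(real ^ 'd \<Rightarrow> real) \<Rightarrow> ('m::finite \<Rightarrow> real ^ 'd \<Rightarrow> real) \<Rightarrow> real ^ 'd \<Rightarrow> real ^ 'm \<Rightarrow> bool" where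
  "KKT_pair f0 f x lam \<longleftrightarrow>
     x \<in> feasible_set f \<and> (\<forall>i. 0 \<le> lam $ i) \<and>
     grad f0 x + (\<Sum>i\<in>UNIV. (lam $ i) *\<^sub>R grad (f i) x) = 0 \<and>
     (\<forall>i. lam $ i * f i x = 0)"

end

theory Submission
  imports Defs
begin

text \<open>
  Every iterate is strictly feasible: points within \<open>l_star\<close> of \<open>x k\<close> are by the Lipschitz bound, and
  farther away the term \<open>2 M\<^sub>i \<parallel>y - x k\<parallel>\<^sup>2\<close> exceeds the Taylor remainder plus the finite-difference error.
  The Lipschitz bounds hold only on the feasible set, so the segment from \<open>x k\<close> to \<open>y\<close> is followed up to
  its first exit. Moreover \<open>f0\<close> decreases along the iterates, and having a convergent subsequence,
  \<open>f0 (x k)\<close> converges. Suppose the accumulation point \<open>xc\<close> is not a KKT point. By linear independence of the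
  active gradients there is then a direction \<open>v\<close> along which \<open>f0\<close> and all active constraints strictly
  decrease to first order at \<open>xc\<close>. For a fixed small \<open>t\<close>, the point \<open>x k + t v\<close> satisfies the
  constraints of the \<open>k\<close>-th subproblem whenever \<open>x k\<close> is close to \<open>xc\<close> and \<open>k\<close> is large, so \<open>f0\<close>
  decreases by a fixed amount infinitely often, which is impossible. No duality theory for the
  subproblems is needed.
\<close>

section \<open>Quadratic Taylor bounds and finite differences\<close>

text \<open>Subtracting the tangent and the quadratic term leaves a function \<phi> of the segment
  parameter whose derivative is nonpositive, by Cauchy-Schwarz and the Lipschitz gradient. The
  Lipschitz bound is asked on the segment alone because the feasible set may be nonconvex.\<close>

lemma taylor_quadratic_upper:
  fixes h :: "'a::real_inner \<Rightarrow> real"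
  assumes D: "\<And>y. y \<in> closed_segment a b \<Longrightarrow> GDERIV h y :> G y"
    and lip: "M-lipschitz_on (closed_segment a b) G"
  shows "h b \<le> h a + G a \<bullet> (b - a) + M / 2 * (norm (b - a))\<^sup>2"
proof -
  define v where "v = b - a"
  define \<phi> where "\<phi> = (\<lambda>s. h (a + s *\<^sub>R v) - s * (G a \<bullet> v) - M / 2 * s\<^sup>2 * (norm v)\<^sup>2)"
  have seg: "a + s *\<^sub>R v \<in> closed_segment a b" if "0 \<le> s" "s \<le> 1" for s
    using that unfolding closed_segment_def v_def
    by (auto intro!: exI[of _ s] simp: algebra_simps)
  have "\<phi> 1 \<le> \<phi> 0"
  proof (rule DERIV_nonpos_imp_nonincreasing[where f = \<phi> and a = 0 and b = 1])
    fix s :: real assume s: "0 \<le> s" "s \<le> 1"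
    have Dh: "(h has_derivative (\<lambda>u. u \<bullet> G (a + s *\<^sub>R v))) (at (a + s *\<^sub>R v))"
      using D[OF seg[OF s]] by (simp add: gderiv_def)
    have "((\<lambda>s. a + s *\<^sub>R v) has_derivative (\<lambda>u. u *\<^sub>R v)) (at s)"
      by (auto intro!: derivative_eq_intros)
    then have "((\<lambda>s. h (a + s *\<^sub>R v)) has_derivative (\<lambda>u. (u *\<^sub>R v) \<bullet> G (a + s *\<^sub>R v))) (at s)"
      using has_derivative_compose Dh by blast
    then have Dc: "((\<lambda>s. h (a + s *\<^sub>R v)) has_real_derivative (v \<bullet> G (a + s *\<^sub>R v))) (at s)"
      by (simp add: has_field_derivative_def mult_commute_abs)
    have "(\<phi> has_real_derivative
        (v \<bullet> G (a + s *\<^sub>R v) - G a \<bullet> v - M * s * (norm v)\<^sup>2)) (at s)"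
      unfolding \<phi>_def by (rule derivative_eq_intros Dc refl | simp)+
    moreover have "v \<bullet> G (a + s *\<^sub>R v) - G a \<bullet> v \<le> M * s * (norm v)\<^sup>2"
    proof -
      have "v \<bullet> G (a + s *\<^sub>R v) - G a \<bullet> v = v \<bullet> (G (a + s *\<^sub>R v) - G a)"
        by (simp add: inner_diff_right inner_commute)
      also have "\<dots> \<le> norm v * norm (G (a + s *\<^sub>R v) - G a)"
        by (rule norm_cauchy_schwarz)
      also have "\<dots> \<le> norm v * (M * (s * norm v))"
        using lipschitz_onD[OF lip seg[OF s] ends_in_segment(1)] s
        by (intro mult_left_mono) (auto simp: dist_norm)
      finally show ?thesis by (simp add: power2_eq_square algebra_simps)
    qed
    ultimately show "\<exists>y. DERIV \<phi> s :> y \<and> y \<le> 0" by force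
  qed simp
  then show ?thesis by (simp add: \<phi>_def v_def)
qed

lemma taylor_quadratic_abs:
  fixes h :: "'a::real_inner \<Rightarrow> real"
  assumes "\<And>y. y \<in> closed_segment a b \<Longrightarrow> GDERIV h y :> G y"
    and "M-lipschitz_on (closed_segment a b) G"
  shows "\<bar>h b - h a - G a \<bullet> (b - a)\<bar> \<le> M / 2 * (norm (b - a))\<^sup>2"
proof -
  \<comment> \<open>The lower bound is the upper bound for \<open>- h\<close>.\<close>
  have "- h b \<le> - h a + (- G a) \<bullet> (b - a) + M / 2 * (norm (b - a))\<^sup>2"
    using assms
    by (intro taylor_quadratic_upper[where h = "\<lambda>y. - h y" and G = "\<lambda>y. - G y"])
      (auto intro: GDERIV_minus)
  with taylor_quadratic_upper[OF assms] show ?thesis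
    unfolding abs_le_iff inner_minus_left by linarith
qed

lemma norm_le_sqrt_card:
  fixes w :: "real ^ 'd"
  assumes "\<And>j. \<bar>w $ j\<bar> \<le> c"
  shows "norm w \<le> sqrt (real CARD('d)) * c"
proof -
  have c: "0 \<le> c" using assms[of undefined] by linarith
  have "(\<Sum>j\<in>UNIV. (w $ j)\<^sup>2) \<le> (\<Sum>j\<in>(UNIV :: 'd set). c\<^sup>2)"
    using assms c by (intro sum_mono) (simp add: abs_le_square_iff[symmetric])
  then have "norm w \<le> sqrt (real CARD('d) * c\<^sup>2)"
    by (simp add: norm_vec_def L2_set_def)
  with c show ?thesis by (simp add: real_sqrt_mult)
qed

lemma fd_grad_component:
  "fd_grad \<nu> h a $ j = (h (a + \<nu> *\<^sub>R axis j 1) - h a) / \<nu>"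
  unfolding fd_grad_def by (simp add: axis_def if_distrib cong: if_cong)

text \<open>Each component is a forward difference along one axis, whose Taylor remainder divided by
  \<nu> is at most \<open>M * \<nu> / 2\<close>. The factor \<open>sqrt (real CARD('d))\<close>
  passes from the maximum norm to the Euclidean one.\<close>

lemma fd_grad_error:
  fixes h :: "real ^ 'd \<Rightarrow> real"
  assumes D: "\<And>y. GDERIV h y :> G y"
    and lip: "M-lipschitz_on C G"
    and seg: "\<And>j. closed_segment a (a + \<nu> *\<^sub>R axis j 1) \<subseteq> C"
    and \<nu>: "0 < \<nu>"
  shows "norm (fd_grad \<nu> h a - G a) \<le> sqrt (real CARD('d)) * (M * \<nu> / 2)"
proof (rule norm_le_sqrt_card)
  fix j
  define w where "w = (fd_grad \<nu> h a - G a) $ j"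
  have "\<bar>h (a + \<nu> *\<^sub>R axis j 1) - h a - G a \<bullet> (\<nu> *\<^sub>R axis j 1)\<bar> \<le> M / 2 * \<nu>\<^sup>2"
    using taylor_quadratic_abs[OF D lipschitz_on_subset[OF lip seg[of j]]]
    by (simp add: norm_axis_1)
  moreover have "h (a + \<nu> *\<^sub>R axis j 1) - h a - G a \<bullet> (\<nu> *\<^sub>R axis j 1) = \<nu> * w"
    using \<nu> by (simp add: w_def fd_grad_component inner_axis field_simps)
  ultimately have "\<nu> * \<bar>w\<bar> \<le> \<nu> * (M * \<nu> / 2)"
    using \<nu> by (simp add: abs_mult power2_eq_square ac_simps)
  with \<nu> show "\<bar>(fd_grad \<nu> h a - G a) $ j\<bar> \<le> M * \<nu> / 2"
    unfolding w_def[symmetric] using mult_le_cancel_left_pos by blast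
qed

section \<open>Strict feasibility of the iterates\<close>

text \<open>Continuous induction by a first exit time. It will be used with \<open>U\<close> the
  strictly feasible and \<open>C\<close> the feasible points: estimates valid only while the path is
  feasible then show that it never touches the boundary.\<close>

lemma path_stays_in_open:
  fixes p :: "real \<Rightarrow> 'a::topological_space"
  assumes cont: "continuous_on {0..1} p"
    and U: "open U" "p 0 \<in> U" and C: "closed C" "U \<subseteq> C"
    and step: "\<And>t. \<lbrakk>0 \<le> t; t \<le> 1; \<And>s. \<lbrakk>0 \<le> s; s \<le> t\<rbrakk> \<Longrightarrow> p s \<in> C\<rbrakk> \<Longrightarrow> p t \<in> U"
    and t: "0 \<le> t" "t \<le> 1"
  shows "p t \<in> U"
proof (rule ccontr)
  assume "p t \<notin> U"
  \<comment> \<open>The times outside \<open>U\<close> form a compact set, so there is a first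
    one.\<close>
  define B where "B = {0..1} \<inter> p -` (- U)"
  have "compact B"
    unfolding B_def compact_eq_bounded_closed
    using continuous_closed_preimage[OF cont closed_atLeastAtMost, of "- U"] U
    by (auto intro: bounded_subset[OF bounded_closed_interval])
  moreover have "B \<noteq> {}" using \<open>p t \<notin> U\<close> t by (auto simp: B_def)
  ultimately obtain t0 where t0: "t0 \<in> B" "\<And>s. s \<in> B \<Longrightarrow> t0 \<le> s"
    using compact_attains_inf by metis
  have t0': "0 < t0" "t0 \<le> 1" "p t0 \<notin> U"
    using t0(1) U by (auto simp: B_def order.order_iff_strict)
  have below: "p s \<in> U" if "0 \<le> s" "s < t0" for s
    using t0(2)[of s] that t0' by (auto simp: B_def)
  \<comment> \<open>The path lies in \<open>U\<close> before \<open>t0\<close>, so its limit from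
    the left lies in the closed set \<open>C\<close>.\<close>
  have "p t0 \<in> C"
  proof -
    have "(p \<longlongrightarrow> p t0) (at t0 within {0..<t0})"
      using cont t0' unfolding continuous_on_def
      by (meson atLeastAtMost_iff atLeastLessThan_subseteq_atLeastAtMost_iff
          less_eq_real_def order_refl tendsto_within_subset)
    moreover have "eventually (\<lambda>s. p s \<in> C) (at t0 within {0..<t0})"
      unfolding eventually_at_filter
      by (intro always_eventually) (use below C in auto)
    moreover have "at t0 within {0..<t0} \<noteq> bot"
      using t0' by (simp add: at_within_eq_bot_iff)
    ultimately show ?thesis using Lim_in_closed_set[OF C(1)] by blast
  qed
  then have "p s \<in> C" if "0 \<le> s" "s \<le> t0" for s
    using below[of s] that C by (cases "s = t0") auto
  then have "p t0 \<in> U" using step t0' by force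
  with t0' show False by simp
qed

definition strictly_feasible_set :: "('m::finite \<Rightarrow> real ^ 'd \<Rightarrow> real) \<Rightarrow> (real ^ 'd) set" where
  "strictly_feasible_set f = {x. \<forall>i. f i x < 0}"

text \<open>Over a finite index type this is a finite intersection, which preserves
  openness.\<close>

lemma Collect_all_UNIV_INT: "{x. \<forall>i. P i x} = (\<Inter>i. {x. P i x})"
  by auto

lemma closed_feasible_set:
  assumes "\<And>i. continuous_on UNIV (f i)"
  shows "closed (feasible_set f)"
  unfolding feasible_set_def using assms
  by (intro closed_Collect_all closed_Collect_le continuous_intros) auto

lemma open_strictly_feasible_set:
  assumes "\<And>i. continuous_on UNIV (f i)"
  shows "open (strictly_feasible_set f)"
  unfolding strictly_feasible_set_def Collect_all_UNIV_INT using assms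
  by (intro open_INT ballI open_Collect_less continuous_intros) auto

lemma strictly_feasible_subset: "strictly_feasible_set f \<subseteq> feasible_set f"
  by (auto simp: strictly_feasible_set_def feasible_set_def less_imp_le)

text \<open>The subproblem's feasible set is star-shaped about \<open>y\<close>: as
  \<open>t\<^sup>2 \<le> t\<close>, each constraint at parameter \<open>t\<close> is at most
  \<open>1 - t\<close> times its value at \<open>y\<close> plus \<open>t\<close> times its value at
  \<open>x\<close>.\<close>

lemma local_feasible_set_segment:
  assumes y: "y \<in> strictly_feasible_set f"
    and x: "x \<in> local_feasible_set \<nu> M f y"
    and M: "\<And>i. 0 \<le> M i"
    and t: "0 \<le> t" "t \<le> 1"
  shows "y + t *\<^sub>R (x - y) \<in> local_feasible_set \<nu> M f y"
  unfolding local_feasible_set_def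
proof safe
  fix i
  let ?g = "fd_grad \<nu> (f i) y \<bullet> (x - y)" and ?q = "2 * M i * (norm (x - y))\<^sup>2"
  have q: "f i y + ?g + ?q \<le> 0" "f i y < 0"
    using x y by (auto simp: local_feasible_set_def strictly_feasible_set_def)
  have "t\<^sup>2 * ?q \<le> t * ?q"
    using t M[of i] by (intro mult_right_mono) (auto simp: power2_eq_square mult_left_le)
  moreover have "t * (f i y + ?g + ?q) \<le> 0" "(1 - t) * f i y \<le> 0"
    using q t by (auto simp: mult_le_0_iff)
  ultimately have "f i y + t * ?g + t\<^sup>2 * ?q \<le> 0"
    by (simp add: algebra_simps)
  then show "f i y + fd_grad \<nu> (f i) y \<bullet> (y + t *\<^sub>R (x - y) - y)
      + 2 * M i * (norm (y + t *\<^sub>R (x - y) - y))\<^sup>2 \<le> 0"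
    by (simp add: power_mult_distrib ac_simps)
qed

section \<open>Geometry of the constraints around a strictly feasible point\<close>

context
  fixes f :: "'m::finite \<Rightarrow> real ^ 'd \<Rightarrow> real" and G :: "'m \<Rightarrow> real ^ 'd \<Rightarrow> real ^ 'd"
    and L M :: "'m \<Rightarrow> real"
  assumes D: "\<And>i y. GDERIV (f i) y :> G i y"
    and L_pos: "\<And>i. 0 < L i" and M_pos: "\<And>i. 0 < M i"
    and lip: "\<And>i. (L i)-lipschitz_on (feasible_set f) (f i)"
    and lip_grad: "\<And>i. (M i)-lipschitz_on (feasible_set f) (G i)"
begin

lemma continuous_constraint: "continuous_on UNIV (f i)"
proof (intro continuous_at_imp_continuous_on ballI)
  show "isCont (f i) y" for y
    using D[of i y] unfolding gderiv_def by (rule has_derivative_continuous)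
qed

lemma L_max_pos: "0 < (MAX i. L i)"
proof -
  have "L undefined \<le> (MAX i. L i)" by (rule Max_ge) auto
  with L_pos[of undefined] show ?thesis by linarith
qed

lemma l_star_pos:
  assumes "y \<in> strictly_feasible_set f"
  shows "0 < l_star L f y"
proof -
  have "0 < (MIN i. - f i y)"
    using assms by (subst Min_gr_iff) (auto simp: strictly_feasible_set_def)
  with L_max_pos show ?thesis by (simp add: l_star_def)
qed

lemma alpha_max_pos: "0 < alpha_max TYPE('d) M"
proof -
  have "0 < sqrt (real CARD('d)) * M undefined / 2" using M_pos by simp
  also have "\<dots> \<le> alpha_max TYPE('d) M" unfolding alpha_max_def by (rule Max_ge) auto
  finally show ?thesis .
qed

lemma nu_star_pos:
  assumes "y \<in> strictly_feasible_set f" "0 < \<Lambda>" "0 < \<eta>"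
  shows "0 < nu_star \<Lambda> \<eta> L M f k y"
  using l_star_pos[OF assms(1)] alpha_max_pos assms
  by (simp add: nu_star_def)

lemma L_mult_l_star_le: "L i * l_star L f y \<le> - f i y" if "y \<in> strictly_feasible_set f"
proof -
  have "L i * l_star L f y \<le> (MAX i. L i) * l_star L f y"
    using l_star_pos[OF that] by (intro mult_right_mono) auto
  also have "\<dots> = (MIN i. - f i y)" using L_max_pos by (simp add: l_star_def)
  also have "\<dots> \<le> - f i y" by (rule Min_le) auto
  finally show ?thesis .
qed

text \<open>Moving by less than \<open>l_star\<close> raises each constraint by less than its slack.
  Feasibility of \<open>z\<close> is assumed because the Lipschitz bound is available only
  there.\<close>

lemma strictly_feasible_if_near:
  assumes y: "y \<in> strictly_feasible_set f" and z: "z \<in> feasible_set f"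
    and near: "norm (z - y) < l_star L f y"
  shows "z \<in> strictly_feasible_set f"
  unfolding strictly_feasible_set_def
proof safe
  fix i
  have "f i z \<le> f i y + L i * norm (z - y)"
    using lipschitz_onD[OF lip[of i] z, of y] y strictly_feasible_subset
    by (force simp: dist_norm)
  also have "\<dots> < f i y + L i * l_star L f y"
    using near L_pos by simp
  also have "\<dots> \<le> 0" using L_mult_l_star_le[OF y, of i] by simp
  finally show "f i z < 0" .
qed

text \<open>Feasibility of the nearby point need not be assumed:
  \<open>strictly_feasible_if_near\<close> serves as the step of the first-exit argument along the
  radius.\<close>

lemma ball_l_star_subset:
  assumes y: "y \<in> strictly_feasible_set f"
  shows "ball y (l_star L f y) \<subseteq> strictly_feasible_set f"
proof
  fix z assume z: "z \<in> ball y (l_star L f y)"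
  have "y + 1 *\<^sub>R (z - y) \<in> strictly_feasible_set f"
  proof (rule path_stays_in_open[where p = "\<lambda>t. y + t *\<^sub>R (z - y)" and C = "feasible_set f"])
    fix t :: real
    assume t: "0 \<le> t" "t \<le> 1"
      and C: "\<And>s. \<lbrakk>0 \<le> s; s \<le> t\<rbrakk> \<Longrightarrow> y + s *\<^sub>R (z - y) \<in> feasible_set f"
    have "t * norm (z - y) \<le> norm (z - y)" using t by (simp add: mult_left_le_one_le)
    then have "norm (y + t *\<^sub>R (z - y) - y) < l_star L f y"
      using z t by (simp add: dist_norm norm_minus_commute)
    then show "y + t *\<^sub>R (z - y) \<in> strictly_feasible_set f"
      using strictly_feasible_if_near[OF y] C t by blast
  qed (use y continuous_constraint strictly_feasible_subset in
      \<open>auto intro!: continuous_intros open_strictly_feasible_set closed_feasible_set\<close>)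
  then show "z \<in> strictly_feasible_set f" by simp
qed

lemma cball_l_star_subset:
  assumes y: "y \<in> strictly_feasible_set f"
  shows "cball y (l_star L f y) \<subseteq> feasible_set f"
proof -
  have "closure (ball y (l_star L f y)) \<subseteq> feasible_set f"
    using ball_l_star_subset[OF y] strictly_feasible_subset closed_feasible_set continuous_constraint
    by (intro closure_minimal) blast+
  with l_star_pos[OF y] show ?thesis by simp
qed

text \<open>The sample points lie in the closed ball of radius \<open>l_star\<close>, which is
  convex and feasible, so the gradient is Lipschitz along every sampling segment.\<close>

lemma fd_grad_error_feasible:
  assumes y: "y \<in> strictly_feasible_set f"
    and \<nu>: "0 < \<nu>" "\<nu> \<le> l_star L f y / sqrt (real CARD('d))"
  shows "norm (fd_grad \<nu> (f i) y - G i y) \<le> sqrt (real CARD('d)) * (M i * \<nu> / 2)"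
proof (rule fd_grad_error[OF D lip_grad _ \<nu>(1)])
  fix j :: 'd
  have "\<nu> \<le> l_star L f y"
  proof -
    have "l_star L f y / sqrt (real CARD('d)) \<le> l_star L f y / 1"
      using l_star_pos[OF y] by (intro divide_left_mono) (auto simp: Suc_leI)
    with \<nu> show ?thesis by simp
  qed
  then have "closed_segment y (y + \<nu> *\<^sub>R axis j 1) \<subseteq> cball y (l_star L f y)"
    using \<nu> l_star_pos[OF y]
    by (intro closed_segment_subset) (auto simp: dist_norm norm_axis_1)
  with cball_l_star_subset[OF y]
  show "closed_segment y (y + \<nu> *\<^sub>R axis j 1) \<subseteq> feasible_set f" by blast
qed

text \<open>First-exit argument from \<open>y\<close> to \<open>x\<close>, with two regimes for a
  point \<open>z\<close> at distance \<open>r\<close> from \<open>y\<close>. Below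
  \<open>l_star\<close> the Lipschitz bound suffices; beyond it the quadratic term dominates all
  errors.\<close>

lemma local_feasible_set_strictly_feasible:
  assumes y: "y \<in> strictly_feasible_set f"
    and \<nu>: "0 < \<nu>" "\<nu> \<le> l_star L f y / sqrt (real CARD('d))"
    and x: "x \<in> local_feasible_set \<nu> M f y"
  shows "x \<in> strictly_feasible_set f"
proof -
  have "y + 1 *\<^sub>R (x - y) \<in> strictly_feasible_set f"
  proof (rule path_stays_in_open[where p = "\<lambda>t. y + t *\<^sub>R (x - y)" and C = "feasible_set f"])
    fix t :: real
    assume t: "0 \<le> t" "t \<le> 1"
      and C: "\<And>s. \<lbrakk>0 \<le> s; s \<le> t\<rbrakk> \<Longrightarrow> y + s *\<^sub>R (x - y) \<in> feasible_set f"
    define z where "z = y + t *\<^sub>R (x - y)"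
    define r where "r = norm (z - y)"
    have zC: "z \<in> feasible_set f" using C t by (simp add: z_def)
    \<comment> \<open>The path hypothesis makes the part already travelled feasible, so Taylor's
      bound applies on it.\<close>
    have seg: "closed_segment y z \<subseteq> feasible_set f"
    proof
      fix w assume "w \<in> closed_segment y z"
      then obtain u where u: "0 \<le> u" "u \<le> 1" "w = (1 - u) *\<^sub>R y + u *\<^sub>R z"
        by (auto simp: closed_segment_def)
      then have "w = y + (u * t) *\<^sub>R (x - y)" by (simp add: z_def algebra_simps)
      moreover have "u * t \<le> t" using u t by (simp add: mult_left_le_one_le)
      ultimately show "w \<in> feasible_set f" using C u t by simp
    qed
    have zS: "z \<in> local_feasible_set \<nu> M f y"
      unfolding z_def using local_feasible_set_segment[OF y x _ t] M_pos less_imp_le by blast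
    show "z \<in> strictly_feasible_set f"
    proof (cases "r < l_star L f y")
      case True
      then show ?thesis using strictly_feasible_if_near[OF y zC] by (simp add: r_def)
    next
      case False
      then have r: "0 < l_star L f y" "l_star L f y \<le> r" using l_star_pos[OF y] by auto
      show ?thesis
        unfolding strictly_feasible_set_def
      proof safe
        fix i
        have "norm (fd_grad \<nu> (f i) y - G i y) \<le> M i * (sqrt (real CARD('d)) * \<nu>) / 2"
          using fd_grad_error_feasible[OF y \<nu>, of i] by (simp add: algebra_simps)
        \<comment> \<open>Here
          \<open>sqrt (real CARD('d)) * \<nu> \<le> l_star L f y \<le> r\<close>, which turns the
          sampling error into a multiple of \<open>r\<close>.\<close>
        also have "\<dots> \<le> M i * r / 2"
          using \<nu> r M_pos[of i] by (simp add: field_simps)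
        finally have e: "norm (fd_grad \<nu> (f i) y - G i y) \<le> M i * r / 2" .
        have "(G i y - fd_grad \<nu> (f i) y) \<bullet> (z - y)
            \<le> norm (G i y - fd_grad \<nu> (f i) y) * norm (z - y)"
          by (rule norm_cauchy_schwarz)
        also have "\<dots> \<le> M i * r / 2 * r"
          unfolding r_def[symmetric]
          using e by (intro mult_right_mono) (auto simp: r_def norm_minus_commute)
        finally have 1: "G i y \<bullet> (z - y) \<le> fd_grad \<nu> (f i) y \<bullet> (z - y) + M i / 2 * r\<^sup>2"
          by (simp add: inner_diff_left power2_eq_square)
        have 2: "f i z \<le> f i y + G i y \<bullet> (z - y) + M i / 2 * r\<^sup>2"
          unfolding r_def using D lipschitz_on_subset[OF lip_grad seg]
          by (intro taylor_quadratic_upper)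
        have 3: "f i y + fd_grad \<nu> (f i) y \<bullet> (z - y) + 2 * M i * r\<^sup>2 \<le> 0"
          using zS by (auto simp: local_feasible_set_def r_def)
        \<comment> \<open>Of the coefficient 2 in the subproblem, the Taylor remainder and the
          gradient error use one half each. The remaining \<open>M i * r\<^sup>2\<close> gives
          strictness.\<close>
        have "0 < M i * r\<^sup>2" using r M_pos[of i] by simp
        with 1 2 3 show "f i z < 0" by (simp add: field_simps)
      qed
    qed
  qed (use y continuous_constraint strictly_feasible_subset in
      \<open>auto intro!: continuous_intros open_strictly_feasible_set closed_feasible_set\<close>)
  then show ?thesis by simp
qed

lemma szo_qq_strictly_feasible:
  assumes it: "szo_qq_iterates \<mu> \<Lambda> \<eta> L M f0 f x0 x"
    and x0: "x0 \<in> strictly_feasible_set f" and pos: "0 < \<Lambda>" "0 < \<eta>"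
  shows "x k \<in> strictly_feasible_set f"
proof (induction k)
  case 0
  then show ?case using it x0 by (simp add: szo_qq_iterates_def)
next
  case (Suc k)
  show ?case
  proof (rule local_feasible_set_strictly_feasible[OF Suc nu_star_pos[OF Suc pos]])
    show "nu_star \<Lambda> \<eta> L M f k (x k) \<le> l_star L f (x k) / sqrt (real CARD('d))"
      unfolding nu_star_def by (rule Min_le) auto
    show "x (Suc k) \<in> local_feasible_set (nu_star \<Lambda> \<eta> L M f k (x k)) M f (x k)"
      using it by (simp add: szo_qq_iterates_def is_arg_min_def)
  qed
qed

text \<open>The entry \<open>1 / real (max k 1)\<close> of the minimum defining
  \<open>nu_star\<close> makes the error vanish as k grows, uniformly in \<open>y\<close>.\<close>

lemma szo_qq_fd_grad_error:
  assumes y: "y \<in> strictly_feasible_set f" and pos: "0 < \<Lambda>" "0 < \<eta>"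
  shows "norm (fd_grad (nu_star \<Lambda> \<eta> L M f k y) (f i) y - G i y)
    \<le> sqrt (real CARD('d)) * M i / 2 * (1 / real (max k 1))"
proof -
  let ?\<nu> = "nu_star \<Lambda> \<eta> L M f k y"
  have \<nu>: "?\<nu> \<le> l_star L f y / sqrt (real CARD('d))" "?\<nu> \<le> 1 / real (max k 1)"
    unfolding nu_star_def by (rule Min_le; simp)+
  have "norm (fd_grad ?\<nu> (f i) y - G i y) \<le> sqrt (real CARD('d)) * M i / 2 * ?\<nu>"
    using fd_grad_error_feasible[OF y nu_star_pos[OF y pos] \<nu>(1), of i] by (simp add: ac_simps)
  also have "\<dots> \<le> sqrt (real CARD('d)) * M i / 2 * (1 / real (max k 1))"
    using \<nu>(2) M_pos[of i] by (intro mult_left_mono) auto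
  finally show ?thesis .
qed

end

section \<open>Accumulation points admit no common descent direction\<close>

text \<open>Minimality against the competitor \<open>y\<close>, with the nonnegative proximal term
  of the new iterate dropped.\<close>

lemma szo_qq_descent:
  assumes it: "szo_qq_iterates \<mu> \<Lambda> \<eta> L M f0 f x0 x"
    and y: "y \<in> local_feasible_set (nu_star \<Lambda> \<eta> L M f k (x k)) M f (x k)"
    and \<mu>: "0 \<le> \<mu>"
  shows "f0 (x (Suc k)) \<le> f0 y + \<mu> * (norm (y - x k))\<^sup>2"
proof -
  have "f0 (x (Suc k)) + \<mu> * (norm (x (Suc k) - x k))\<^sup>2 \<le> f0 y + \<mu> * (norm (y - x k))\<^sup>2"
    using it y unfolding szo_qq_iterates_def is_arg_min_linorder by blast
  moreover have "0 \<le> \<mu> * (norm (x (Suc k) - x k))\<^sup>2" using \<mu> by simp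
  ultimately show ?thesis by linarith
qed

text \<open>The subsequence decreases too, so its limit bounds the whole sequence from below;
  monotone convergence does the rest.\<close>

lemma decseq_subseq_LIMSEQ:
  fixes u :: "nat \<Rightarrow> real"
  assumes dec: "decseq u" and s: "strict_mono s" and lim: "(\<lambda>k. u (s k)) \<longlonglongrightarrow> l"
  shows "u \<longlonglongrightarrow> l"
proof -
  have lower: "l \<le> u n" for n
  proof -
    have "decseq (\<lambda>k. u (s k))"
      using dec s by (auto simp: decseq_def strict_mono_less_eq)
    then have "l \<le> u (s n)" using lim decseq_ge by metis
    also have "\<dots> \<le> u n" using dec seq_suble[OF s] by (auto simp: decseq_def)
    finally show ?thesis .
  qed
  obtain l' where l': "u \<longlonglongrightarrow> l'" using decseq_convergent[OF dec] lower by metis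
  with LIMSEQ_subseq_LIMSEQ[OF l' s] lim have "l' = l"
    using LIMSEQ_unique by (auto simp: o_def)
  with l' show ?thesis by simp
qed

text \<open>Meant for the value \<open>u\<close> of a constraint, its slope \<open>c\<close> along a
  direction and a quadratic coefficient \<open>q\<close>. If \<open>u < 0\<close>, continuity at 0
  decides; if \<open>u = 0\<close>, a factor t splits off and the slope decides.\<close>

lemma eventually_small_step:
  fixes u c q :: real
  assumes "u \<le> 0" "u < 0 \<or> c < 0"
  shows "eventually (\<lambda>t. u + t * c + t\<^sup>2 * q < 0) (at_right 0)"
proof (cases "u < 0")
  case True
  have "((\<lambda>t. u + t * c + t\<^sup>2 * q) \<longlongrightarrow> u + 0 * c + 0\<^sup>2 * q) (at_right 0)"
    by (intro tendsto_intros)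
  with True show ?thesis by (simp add: order_tendsto_iff)
next
  case False
  then have u: "u = 0" "c < 0" using assms by auto
  have "((\<lambda>t. c + t * q) \<longlongrightarrow> c + 0 * q) (at_right 0)"
    by (intro tendsto_intros)
  then have "eventually (\<lambda>t. c + t * q < 0) (at_right 0)"
    using u by (simp add: order_tendsto_iff)
  then show ?thesis using eventually_at_right_less[of 0]
  proof eventually_elim
    case (elim t)
    then have "t * (c + t * q) < 0" by (simp add: mult_pos_neg)
    with u show ?case by (simp add: power2_eq_square algebra_simps)
  qed
qed

lemma szo_qq_no_descent_direction:
  fixes f0 :: "real ^ 'd \<Rightarrow> real" and f :: "'m::finite \<Rightarrow> real ^ 'd \<Rightarrow> real"
  assumes D: "\<And>i y. GDERIV (f i) y :> G i y" and contG: "\<And>i. continuous_on UNIV (G i)"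
    and L: "\<And>i. 0 < L i" and M: "\<And>i. 0 < M i"
    and lip: "\<And>i. (L i)-lipschitz_on (feasible_set f) (f i)"
    and lip_grad: "\<And>i. (M i)-lipschitz_on (feasible_set f) (G i)"
    and lin: "linear f0"
    and x0: "x0 \<in> strictly_feasible_set f"
    and pos: "0 < \<mu>" "0 < \<Lambda>" "0 < \<eta>"
    and it: "szo_qq_iterates \<mu> \<Lambda> \<eta> L M f0 f x0 x"
    and acc: "accumulation_point x xc"
  shows "xc \<in> feasible_set f"
    and "\<not> (f0 v < 0 \<and> (\<forall>i\<in>active_set f xc. G i xc \<bullet> v < 0))"
proof -
  note cont = continuous_constraint[OF D L M lip lip_grad]
  note sf = szo_qq_strictly_feasible[OF D L M lip lip_grad it x0 pos(2,3)]
  obtain s where s: "strict_mono s" and lim: "(\<lambda>k. x (s k)) \<longlonglongrightarrow> xc"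
    using acc by (auto simp: accumulation_point_def o_def)
  show feas: "xc \<in> feasible_set f"
    using Lim_in_closed_set[OF closed_feasible_set[OF cont] _ _ lim] sf strictly_feasible_subset
    by (force simp: eventually_sequentially)
  have dec: "decseq (\<lambda>k. f0 (x k))"
  proof (rule decseq_SucI)
    fix k
    \<comment> \<open>The current iterate is admissible in its own subproblem and has no proximal
      cost there.\<close>
    have "x k \<in> local_feasible_set (nu_star \<Lambda> \<eta> L M f k (x k)) M f (x k)"
      using sf[of k] by (auto simp: local_feasible_set_def strictly_feasible_set_def less_imp_le)
    from szo_qq_descent[OF it this] pos show "f0 (x (Suc k)) \<le> f0 (x k)" by simp
  qed
  have "(\<lambda>k. f0 (x (s k))) \<longlonglongrightarrow> f0 xc"
    using linear_conv_bounded_linear lin lim bounded_linear.tendsto by blast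
  from decseq_subseq_LIMSEQ[OF dec s this] have lim0: "(\<lambda>k. f0 (x k)) \<longlonglongrightarrow> f0 xc" .
  have fd_lim: "(\<lambda>k. fd_grad (nu_star \<Lambda> \<eta> L M f (s k) (x (s k))) (f i) (x (s k)))
      \<longlonglongrightarrow> G i xc" for i
  proof -
    have "(\<lambda>k. fd_grad (nu_star \<Lambda> \<eta> L M f k (x k)) (f i) (x k) - G i (x k)) \<longlonglongrightarrow> 0"
    proof (rule Lim_null_comparison)
      show "eventually (\<lambda>k. norm (fd_grad (nu_star \<Lambda> \<eta> L M f k (x k)) (f i) (x k) - G i (x k))
          \<le> sqrt (real CARD('d)) * M i / 2 * (1 / real (max k 1))) sequentially"
        using szo_qq_fd_grad_error[OF D L M lip lip_grad sf pos(2,3)] by simp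
      have "(\<lambda>k. 1 / real (max k 1)) \<longlonglongrightarrow> 0"
        by (rule Lim_transform_eventually[OF lim_1_over_n])
          (auto simp: max_def eventually_sequentially intro!: exI[of _ 1])
      then show "(\<lambda>k. sqrt (real CARD('d)) * M i / 2 * (1 / real (max k 1))) \<longlonglongrightarrow> 0"
        by (rule tendsto_mult_right_zero)
    qed
    from LIMSEQ_subseq_LIMSEQ[OF this s]
    have "(\<lambda>k. fd_grad (nu_star \<Lambda> \<eta> L M f (s k) (x (s k))) (f i) (x (s k)) - G i (x (s k)))
        \<longlonglongrightarrow> 0"
      by (simp add: o_def)
    moreover have "(\<lambda>k. G i (x (s k))) \<longlonglongrightarrow> G i xc"
      using contG[of i] lim by (auto intro: continuous_on_tendsto_compose)
    ultimately show ?thesis using tendsto_add by force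
  qed
  show "\<not> (f0 v < 0 \<and> (\<forall>i\<in>active_set f xc. G i xc \<bullet> v < 0))"
  proof
    assume v: "f0 v < 0 \<and> (\<forall>i\<in>active_set f xc. G i xc \<bullet> v < 0)"
    have "eventually (\<lambda>t. 0 + t * f0 v + t\<^sup>2 * (\<mu> * (norm v)\<^sup>2) < 0) (at_right 0)"
      using v by (intro eventually_small_step) auto
    moreover have "eventually (\<lambda>t. \<forall>i. f i xc + t * (G i xc \<bullet> v) + t\<^sup>2 * (2 * M i * (norm v)\<^sup>2) < 0)
        (at_right 0)"
      using feas v
      by (intro eventually_all_finite eventually_small_step)
        (auto simp: feasible_set_def active_set_def order.order_iff_strict)
    ultimately have "eventually (\<lambda>t. t * f0 v + t\<^sup>2 * (\<mu> * (norm v)\<^sup>2) < 0 \<and>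
        (\<forall>i. f i xc + t * (G i xc \<bullet> v) + t\<^sup>2 * (2 * M i * (norm v)\<^sup>2) < 0)) (at_right 0)"
      by eventually_elim auto
    \<comment> \<open>The step length is chosen from the limit data at \<open>xc\<close>, hence
      independent of k.\<close>
    then obtain t :: real where t0: "t * f0 v + t\<^sup>2 * (\<mu> * (norm v)\<^sup>2) < 0"
      and ti: "\<And>i. f i xc + t * (G i xc \<bullet> v) + t\<^sup>2 * (2 * M i * (norm v)\<^sup>2) < 0"
      using eventually_happens trivial_limit_at_right_real by blast
    have "eventually (\<lambda>k. \<forall>i. f i (x (s k))
        + t * (fd_grad (nu_star \<Lambda> \<eta> L M f (s k) (x (s k))) (f i) (x (s k)) \<bullet> v)
        + t\<^sup>2 * (2 * M i * (norm v)\<^sup>2) < 0) sequentially"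
    \<comment> \<open>The coefficients of the subproblems converge along \<open>s\<close>, so each
      strict inequality at \<open>xc\<close> holds from some index on.\<close>
    proof (intro eventually_all_finite)
      fix i
      have "(\<lambda>k. f i (x (s k))) \<longlonglongrightarrow> f i xc"
        using cont[of i] lim by (auto intro: continuous_on_tendsto_compose)
      then have "(\<lambda>k. f i (x (s k))
          + t * (fd_grad (nu_star \<Lambda> \<eta> L M f (s k) (x (s k))) (f i) (x (s k)) \<bullet> v)
          + t\<^sup>2 * (2 * M i * (norm v)\<^sup>2))
        \<longlonglongrightarrow> f i xc + t * (G i xc \<bullet> v) + t\<^sup>2 * (2 * M i * (norm v)\<^sup>2)"
        by (intro tendsto_intros fd_lim)
      with ti[of i] show "eventually (\<lambda>k. f i (x (s k))
          + t * (fd_grad (nu_star \<Lambda> \<eta> L M f (s k) (x (s k))) (f i) (x (s k)) \<bullet> v)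
          + t\<^sup>2 * (2 * M i * (norm v)\<^sup>2) < 0) sequentially"
        by (simp add: order_tendsto_iff)
    qed
    then have "eventually (\<lambda>k. f0 (x (Suc (s k)))
        \<le> f0 (x (s k)) + (t * f0 v + t\<^sup>2 * (\<mu> * (norm v)\<^sup>2))) sequentially"
    proof eventually_elim
      case (elim k)
      then have "x (s k) + t *\<^sub>R v
          \<in> local_feasible_set (nu_star \<Lambda> \<eta> L M f (s k) (x (s k))) M f (x (s k))"
        by (auto simp: local_feasible_set_def power_mult_distrib algebra_simps less_imp_le)
      from szo_qq_descent[OF it this] pos show ?case
        by (simp add: linear_add[OF lin] linear_scale[OF lin] power_mult_distrib algebra_simps)
    qed
    \<comment> \<open>The successors \<open>x (Suc (s k))\<close> need not converge, but their
      objective values do, to the same limit. A fixed decrease per step contradicts this.\<close>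
    moreover have "(\<lambda>k. f0 (x (Suc (s k)))) \<longlonglongrightarrow> f0 xc"
      using LIMSEQ_subseq_LIMSEQ[OF LIMSEQ_Suc[OF lim0] s] by (simp add: o_def)
    moreover have "(\<lambda>k. f0 (x (s k)) + (t * f0 v + t\<^sup>2 * (\<mu> * (norm v)\<^sup>2)))
        \<longlonglongrightarrow> f0 xc + (t * f0 v + t\<^sup>2 * (\<mu> * (norm v)\<^sup>2))"
      using LIMSEQ_subseq_LIMSEQ[OF lim0 s] by (intro tendsto_add) (auto simp: o_def)
    ultimately have "f0 xc \<le> f0 xc + (t * f0 v + t\<^sup>2 * (\<mu> * (norm v)\<^sup>2))"
      using tendsto_le[OF sequentially_bot] by blast
    with t0 show False by simp
  qed
qed

section \<open>Multipliers from linearly independent gradients\<close>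

text \<open>Values prescribed on an independent set extend to a linear functional; its adjoint at 1
  is the representing vector.\<close>

lemma inner_extend_independent:
  fixes B :: "'a::euclidean_space set" and g :: "'a \<Rightarrow> real"
  assumes "independent B"
  obtains v where "\<And>b. b \<in> B \<Longrightarrow> b \<bullet> v = g b"
proof -
  obtain h where h: "linear h" "\<forall>b\<in>B. h b = g b"
    using linear_independent_extend[OF assms] by blast
  show ?thesis
    using that[of "adjoint h 1"] adjoint_works[OF h(1), of _ 1] h(2) by simp
qed

text \<open>A Farkas-type alternative, proved directly from independence: if \<open>g0\<close>
  leaves the span, or has a positive coefficient when \<open>- g0\<close> is not a nonnegative
  combination, inner products with a suitable \<open>v\<close> can be prescribed so that
  \<open>v\<close> is a common descent direction.\<close>

lemma independent_family_multipliers_or_descent: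
  fixes g0 :: "'a::euclidean_space" and g :: "'i \<Rightarrow> 'a"
  assumes fin: "finite A" and inj: "inj_on g A" and ind: "independent (g ` A)"
    and no_descent: "\<And>v. \<not> (g0 \<bullet> v < 0 \<and> (\<forall>i\<in>A. g i \<bullet> v < 0))"
  obtains c where "\<And>i. i \<in> A \<Longrightarrow> 0 \<le> c i" "g0 + (\<Sum>i\<in>A. c i *\<^sub>R g i) = 0"
proof -
  have "g0 \<in> span (g ` A)"
  proof (rule ccontr)
    assume "g0 \<notin> span (g ` A)"
    \<comment> \<open>Outside the span, all inner products, including that of \<open>g0\<close>, can
      be set to -1.\<close>
    with ind have "independent (insert g0 (g ` A))" by (rule independent_insertI[rotated])
    then obtain v where "\<And>b. b \<in> insert g0 (g ` A) \<Longrightarrow> b \<bullet> v = -1"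
      using inner_extend_independent[where g = "\<lambda>_. -1"] by blast
    with no_descent[of v] show False by simp
  qed
  then have "- g0 \<in> span (g ` A)" by (rule span_neg)
  then obtain w where "- g0 = (\<Sum>b\<in>g ` A. w b *\<^sub>R b)"
    using fin by (auto simp: span_finite)
  then have c: "- g0 = (\<Sum>i\<in>A. w (g i) *\<^sub>R g i)"
    by (simp add: sum.reindex[OF inj])
  have "0 \<le> w (g j)" if j: "j \<in> A" for j
  proof (rule ccontr)
    assume "\<not> 0 \<le> w (g j)"
    then have neg: "w (g j) < 0" by simp
    define S where "S = (\<Sum>i\<in>A - {j}. w (g i))"
    \<comment> \<open>Makes the contribution of the negative multiplier outweigh all the others.\<close>
    define K where "K = (\<bar>S\<bar> + 1) / - w (g j)"
    have K: "0 < K" using neg by (simp add: K_def divide_pos_neg zero_less_divide_iff)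
    obtain v where v: "\<And>b. b \<in> g ` A \<Longrightarrow> b \<bullet> v = (if b = g j then - K else -1)"
      using inner_extend_independent[OF ind, where g = "\<lambda>b. if b = g j then - K else -1"] by blast
    have "- (g0 \<bullet> v) = (\<Sum>i\<in>A. w (g i) * (g i \<bullet> v))"
      using arg_cong[OF c, of "\<lambda>u. u \<bullet> v"] by (simp add: inner_sum_left)
    also have "\<dots> = w (g j) * (g j \<bullet> v) + (\<Sum>i\<in>A - {j}. w (g i) * (g i \<bullet> v))"
      using fin j by (rule sum.remove)
    also have "(\<Sum>i\<in>A - {j}. w (g i) * (g i \<bullet> v)) = (\<Sum>i\<in>A - {j}. - w (g i))"
    proof (rule sum.cong[OF refl])
      fix i assume i: "i \<in> A - {j}"
      \<comment> \<open>Injectivity ensures that only the index \<open>j\<close> receives the value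
        \<open>- K\<close>.\<close>
      then have "g i \<noteq> g j" using inj j by (auto dest: inj_onD)
      with i show "w (g i) * (g i \<bullet> v) = - w (g i)" by (simp add: v)
    qed
    also have "w (g j) * (g j \<bullet> v) = \<bar>S\<bar> + 1"
      using neg j by (simp add: v K_def)
    finally have "g0 \<bullet> v < 0" by (simp add: S_def sum_negf)
    moreover have "\<forall>i\<in>A. g i \<bullet> v < 0" using K by (auto simp: v)
    ultimately show False using no_descent by blast
  qed
  moreover have "g0 + (\<Sum>i\<in>A. w (g i) *\<^sub>R g i) = 0" by (simp flip: c)
  ultimately show ?thesis using that[of "\<lambda>i. w (g i)"] by blast
qed

section \<open>Uniqueness and existence of the multiplier vector\<close>

lemma sum_scaleR_active_set:
  fixes g :: "'m::finite \<Rightarrow> 'a::real_vector"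
  assumes "\<And>i. lam $ i * f i x = 0"
  shows "(\<Sum>i\<in>UNIV. (lam $ i) *\<^sub>R g i) = (\<Sum>i\<in>active_set f x. (lam $ i) *\<^sub>R g i)"
proof (rule sum.mono_neutral_right)
  have "lam $ i = 0" if "i \<notin> active_set f x" for i
    using assms[of i] that by (simp add: active_set_def)
  then show "\<forall>i\<in>UNIV - active_set f x. (lam $ i) *\<^sub>R g i = 0" by simp
qed auto

text \<open>Both vectors vanish off the active set, so their difference gives a vanishing
  combination of the independent active gradients.\<close>

lemma LICQ_imp_KKT_unique:
  assumes licq: "LICQ f x" and K: "KKT_pair f0 f x lam" "KKT_pair f0 f x lam'"
  shows "lam = lam'"
proof -
  let ?A = "active_set f x" and ?g = "\<lambda>i. grad (f i) x"
  have inj: "inj_on ?g ?A" and ind: "independent (?g ` ?A)"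
    using licq by (auto simp: LICQ_def)
  have eq: "(\<Sum>i\<in>?A. (l $ i) *\<^sub>R ?g i) = - grad f0 x" if "KKT_pair f0 f x l" for l
    using that sum_scaleR_active_set[of l f x ?g]
    by (simp add: KKT_pair_def eq_neg_iff_add_eq_0 add.commute)
  have "(\<Sum>i\<in>?A. (lam $ i - lam' $ i) *\<^sub>R ?g i) = 0"
    using eq[OF K(1)] eq[OF K(2)] by (simp add: scaleR_diff_left sum_subtractf)
  \<comment> \<open>Reindexed by the gradients themselves, since \<open>independentD\<close>
    concerns sets.\<close>
  then have sum0: "(\<Sum>b\<in>?g ` ?A. (lam $ the_inv_into ?A ?g b - lam' $ the_inv_into ?A ?g b) *\<^sub>R b) = 0"
    by (simp add: sum.reindex[OF inj] the_inv_into_f_f[OF inj])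
  have "lam $ i = lam' $ i" for i
  proof (cases "i \<in> ?A")
    case True
    then have "lam $ the_inv_into ?A ?g (?g i) - lam' $ the_inv_into ?A ?g (?g i) = 0"
      using independentD[OF ind _ subset_refl sum0] by auto
    with True show ?thesis by (simp add: the_inv_into_f_f[OF inj])
  next
    case False
    with K show ?thesis by (force simp: KKT_pair_def active_set_def)
  qed
  then show ?thesis by (simp add: vec_eq_iff)
qed

lemma KKT_pair_exists:
  fixes f :: "'m::finite \<Rightarrow> real ^ 'd \<Rightarrow> real"
  assumes feas: "x \<in> feasible_set f" and licq: "LICQ f x"
    and no_descent: "\<And>v. \<not> (grad f0 x \<bullet> v < 0 \<and> (\<forall>i\<in>active_set f x. grad (f i) x \<bullet> v < 0))"
  shows "\<exists>lam. KKT_pair f0 f x lam"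
proof -
  let ?A = "active_set f x"
  obtain c where c: "\<And>i. i \<in> ?A \<Longrightarrow> 0 \<le> c i" "grad f0 x + (\<Sum>i\<in>?A. c i *\<^sub>R grad (f i) x) = 0"
    using independent_family_multipliers_or_descent
      [of ?A "\<lambda>i. grad (f i) x" "grad f0 x"] licq no_descent
    by (auto simp: LICQ_def)
  \<comment> \<open>Extension by zero enforces complementary slackness.\<close>
  define lam :: "real ^ 'm" where "lam = (\<chi> i. if i \<in> ?A then c i else 0)"
  have compl: "lam $ i * f i x = 0" for i by (simp add: lam_def active_set_def)
  have "(\<Sum>i\<in>UNIV. (lam $ i) *\<^sub>R grad (f i) x) = (\<Sum>i\<in>?A. c i *\<^sub>R grad (f i) x)"
    unfolding sum_scaleR_active_set[where lam = lam and f = f and x = x, OF compl] by (simp add: lam_def)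
  with c feas compl have "KKT_pair f0 f x lam"
    unfolding KKT_pair_def by (simp add: lam_def)
  then show ?thesis ..
qed

theorem theorem2:
  fixes f0 :: "real ^ 'd \<Rightarrow> real"
    and f :: "'m::finite \<Rightarrow> real ^ 'd \<Rightarrow> real"
    and L0 M0 \<mu> \<Lambda> \<eta> :: real
    and L M :: "'m \<Rightarrow> real"
    and \<Omega>bar :: "(real ^ 'd) set"
    and x0 xc :: "real ^ 'd"
    and x :: "nat \<Rightarrow> real ^ 'd"
  assumes "continuously_differentiable f0"
    and "\<And>i. continuously_differentiable (f i)"
    and "linear f0"
    and "feasible_set f \<subseteq> \<Omega>bar"
    and "smoothness_constants f0 L0 M0 (feasible_set f) \<Omega>bar"
    and "\<And>i. smoothness_constants (f i) (L i) (M i) (feasible_set f) \<Omega>bar"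
    and "\<And>i. f i x0 < 0"
    and "\<exists>\<beta>. bounded {y \<in> feasible_set f. f0 y \<le> \<beta>} \<and> x0 \<in> {y \<in> feasible_set f. f0 y \<le> \<beta>}"
    and "\<mu> > 0" and "\<Lambda> > 0" and "\<eta> > 0"
    and "szo_qq_iterates \<mu> \<Lambda> \<eta> L M f0 f x0 x"
    and "accumulation_point (\<lambda>k. x (Suc k)) xc"
    and "LICQ f xc"
  shows "\<exists>!lam :: real ^ 'm. KKT_pair f0 f xc lam"
proof -
  have D: "GDERIV (f i) y :> grad (f i) y" for i y
    using assms(2) by (rule continuously_differentiable_GDERIV)
  have contG: "continuous_on UNIV (grad (f i))" for i
    using assms(2)[of i] by (simp add: continuously_differentiable_def)
  have L: "0 < L i" and M: "0 < M i"
    and lip: "(L i)-lipschitz_on (feasible_set f) (f i)"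
    and lip_grad: "(M i)-lipschitz_on (feasible_set f) (grad (f i))" for i
    using assms(6)[of i] lipschitz_on_subset[OF _ assms(4)]
    by (auto simp: smoothness_constants_def)
  have x0: "x0 \<in> strictly_feasible_set f"
    using assms(7) by (simp add: strictly_feasible_set_def)
  \<comment> \<open>The sequence from index 1 on is a subsequence of \<open>x\<close>, so the index
    map is shifted by one.\<close>
  have acc: "accumulation_point x xc"
  proof -
    obtain r where "strict_mono r" "(\<lambda>k. x (Suc (r k))) \<longlonglongrightarrow> xc"
      using assms(13) by (auto simp: accumulation_point_def o_def)
    then show ?thesis
      unfolding accumulation_point_def
      by (intro exI[of _ "\<lambda>k. Suc (r k)"]) (auto simp: strict_mono_def o_def)
  qed
  note nd = szo_qq_no_descent_direction[OF D contG L M lip lip_grad assms(3) x0 assms(9-12) acc]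
  \<comment> \<open>A linear map is its own derivative, which turns \<open>f0 v < 0\<close> into the
    gradient form.\<close>
  have f0: "f0 v = grad f0 xc \<bullet> v" for v
  proof -
    have "(f0 has_derivative (\<lambda>v. v \<bullet> grad f0 xc)) (at xc)"
      using continuously_differentiable_GDERIV[OF assms(1)] by (simp add: gderiv_def)
    moreover have "(f0 has_derivative f0) (at xc)"
      using assms(3) by (simp add: linear_conv_bounded_linear bounded_linear_imp_has_derivative)
    ultimately have "f0 = (\<lambda>v. v \<bullet> grad f0 xc)" by (metis has_derivative_unique)
    then show ?thesis by (metis inner_commute)
  qed
  have "\<exists>lam. KKT_pair f0 f xc lam"
    using KKT_pair_exists[OF nd(1) assms(14), of f0] nd(2) f0 by simp
  then show ?thesis using LICQ_imp_KKT_unique[OF assms(14)] by blast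
qed

end
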